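(* Let $\sigma$ and $\tau$ be simple types. If $\sigma\trianglelefteq^1\tau$ is derivable in system CF, then $\sigma\trianglelefteq^1\tau$ is also derivable in system LPS. In particular, CF is sound for affine retractions: if $\sigma\trianglelefteq^1\tau$ is derivable in CF, then $\sigma$ is a retract of $\tau$ via an affine coder and an affine decoder.
   Context: Simple types are built from type variables (atoms) $a,b,c,\dots$ (many distinct atoms) with $\to$. If $\tau=\tau_1\to\cdots\to\tau_k\to a$ with $a$ an atom, then $head(\tau)=a$. Terms are simply typed $\lambda$-terms in Church style. Retraction: $\rho\trianglelefteq\tau$ means that there are a type environment $E$ and terms $C$ (the coder), $D$ (the decoder) with $E,(x:\rho)\vdash C:\tau$, $E\vdash D:\tau\to\rho$, $x\notin FV(D)$, and $DC=_{\beta\eta}x$. The types of the free variables declared in $E$ are arbitrary. A $\lambda$-term is affine (a BCK-term) if each variable occurs in it at most once. Semantically, $\rho\trianglelefteq^1\tau$ means that $\rho\trianglelefteq\tau$ holds with an affine coder $C$ and an affine decoder $D$. Isomorphism convention: $\sim$ is the least equivalence relation on simple types such that (1) $\tau\sim\tau'$ and $\sigma\sim\sigma'$ imply $(\tau\to\sigma)\sim(\tau'\to\sigma')$, and (2) $(\tau\to\sigma\to\rho)\sim(\sigma\to\tau\to\rho)$. Types related by $\sim$ are identified, in particular in derivations. For a finite multiset of types $\Sigma=\{\tau_1,\dots,\tau_k\}$, $\Sigma\to\rho$ denotes (any representative of the $\sim$-class of) $\tau_1\to\cdots\to\tau_k\to\rho$ (just $\rho$ if $\Sigma$ is empty). System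 CF derives statements $\rho\trianglelefteq^1\tau$ (types modulo $\sim$) from: (Axiom) $a\trianglelefteq^1 a$, for each atom $a$. (H) from $\sigma\trianglelefteq^1\sigma'$ and $\tau\trianglelefteq^1\tau'$ infer $\sigma\to\tau\trianglelefteq^1\sigma'\to\tau'$. (N) from $\rho\trianglelefteq^1\tau$ infer $\rho\trianglelefteq^1\Sigma\to\tau$. (D) from $\Delta_1\to a\trianglelefteq^1\sigma_1,\ \dots,\ \Delta_n\to a\trianglelefteq^1\sigma_n$ infer $\Delta_1\cup\dots\cup\Delta_n\to a\ \trianglelefteq^1\ \{\Sigma_1\to\sigma_1\to a,\dots,\Sigma_n\to\sigma_n\to a\}\to a$. Here $\Sigma,\Sigma_i,\Delta_i$ are arbitrary finite multisets of types, $\cup$ is multiset union, and $a$ is an atom. System LPS derives statements $\rho\trianglelefteq^1\tau$ (types modulo $\sim$) from: (A1) $\sigma\trianglelefteq^1\sigma$. (A2) $\sigma\trianglelefteq^1\tau\to\sigma$. (A4) $\sigma\trianglelefteq^1(\sigma\to a)\to a$, provided $head(\sigma)=a$ ($a$ an arbitrary atom). (R1) from $\sigma\trianglelefteq^1\tau$ and $\tau\trianglelefteq^1\rho$ infer $\sigma\trianglelefteq^1\rho$. (R2) from $\sigma\trianglelefteq^1\sigma'$ and $\tau\trianglelefteq^1\tau'$ infer $\sigma\to\tau\trianglelefteq^1\sigma'\to\tau'$. *)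

theory Defs
  imports "HOL-Library.Multiset"
begin

section \<open>Simple types\<close>

datatype 'a ty = Atom 'a | Arrow "'a ty" "'a ty" (infixr "\<rightarrow>" 65)

primrec head :: "'a ty \<Rightarrow> 'a" where
  "head (Atom a) = a"
| "head (\<sigma> \<rightarrow> \<tau>) = head \<tau>"

inductive ty_iso :: "'a ty \<Rightarrow> 'a ty \<Rightarrow> bool" (infix "\<sim>" 50) where
  iso_refl: "\<tau> \<sim> \<tau>"
| iso_sym: "\<tau> \<sim> \<sigma> \<Longrightarrow> \<sigma> \<sim> \<tau>"
| iso_trans: "\<tau> \<sim> \<sigma> \<Longrightarrow> \<sigma> \<sim> \<rho> \<Longrightarrow> \<tau> \<sim> \<rho>"
| iso_arrow: "\<tau> \<sim> \<tau>' \<Longrightarrow> \<sigma> \<sim> \<sigma>' \<Longrightarrow> \<tau> \<rightarrow> \<sigma> \<sim> \<tau>' \<rightarrow> \<sigma>'"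
| iso_swap: "\<tau> \<rightarrow> \<sigma> \<rightarrow> \<rho> \<sim> \<sigma> \<rightarrow> \<tau> \<rightarrow> \<rho>"

text \<open>The order in which the elements of the multiset are listed is irrelevant up to \<open>\<sim>\<close>;
  the choice operator picks one of these representatives.\<close>

definition arrows :: "'a ty multiset \<Rightarrow> 'a ty \<Rightarrow> 'a ty" (infixr "\<Rrightarrow>" 65) where
  "\<Sigma> \<Rrightarrow> \<rho> = foldr Arrow (SOME ts. mset ts = \<Sigma>) \<rho>"

section \<open>The derivation systems\<close>

text \<open>Both systems work with types modulo \<open>\<sim>\<close>. This is expressed on representatives by the
  rules \<open>CF_iso\<close> and \<open>LPS_iso\<close>, which close derivability under \<open>\<sim>\<close> on both sides.\<close>

inductive CF :: "'a ty \<Rightarrow> 'a ty \<Rightarrow> bool" where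
  CF_iso: "CF \<rho> \<tau> \<Longrightarrow> \<rho> \<sim> \<rho>' \<Longrightarrow> \<tau> \<sim> \<tau>' \<Longrightarrow> CF \<rho>' \<tau>'"
| CF_Axiom: "CF (Atom a) (Atom a)"
| CF_H: "CF \<sigma> \<sigma>' \<Longrightarrow> CF \<tau> \<tau>' \<Longrightarrow> CF (\<sigma> \<rightarrow> \<tau>) (\<sigma>' \<rightarrow> \<tau>')"
| CF_N: "CF \<rho> \<tau> \<Longrightarrow> CF \<rho> (\<Sigma> \<Rrightarrow> \<tau>)"
| CF_D: "(\<And>i. i < (n::nat) \<Longrightarrow> CF (\<Delta> i \<Rrightarrow> Atom a) (\<sigma> i)) \<Longrightarrow>
    CF ((\<Sum>i<n. \<Delta> i) \<Rrightarrow> Atom a)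
       ({# \<Sigma> i \<Rrightarrow> \<sigma> i \<rightarrow> Atom a. i \<in># mset_set {..<n} #} \<Rrightarrow> Atom a)"

inductive LPS :: "'a ty \<Rightarrow> 'a ty \<Rightarrow> bool" where
  LPS_iso: "LPS \<rho> \<tau> \<Longrightarrow> \<rho> \<sim> \<rho>' \<Longrightarrow> \<tau> \<sim> \<tau>' \<Longrightarrow> LPS \<rho>' \<tau>'"
| LPS_A1: "LPS \<sigma> \<sigma>"
| LPS_A2: "LPS \<sigma> (\<tau> \<rightarrow> \<sigma>)"
| LPS_A4: "head \<sigma> = a \<Longrightarrow> LPS \<sigma> ((\<sigma> \<rightarrow> Atom a) \<rightarrow> Atom a)"
| LPS_R1: "LPS \<sigma> \<tau> \<Longrightarrow> LPS \<tau> \<rho> \<Longrightarrow> LPS \<sigma> \<rho>"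
| LPS_R2: "LPS \<sigma> \<sigma>' \<Longrightarrow> LPS \<tau> \<tau>' \<Longrightarrow> LPS (\<sigma> \<rightarrow> \<tau>) (\<sigma>' \<rightarrow> \<tau>')"

section \<open>Church-style terms\<close>

text \<open>Terms are in de Bruijn notation: \<open>Var i\<close> refers to the \<open>i\<close>-th enclosing binder, or, beyond
  those, to the \<open>i\<close>-th entry of the type environment.\<close>

datatype 'a trm = Var nat | App "'a trm" "'a trm" | Lam "'a ty" "'a trm"

inductive typing :: "'a ty list \<Rightarrow> 'a trm \<Rightarrow> 'a ty \<Rightarrow> bool" ("_ \<turnstile> _ \<Colon> _" [51, 51, 51] 50) where
  typing_Var: "i < length E \<Longrightarrow> E \<turnstile> Var i \<Colon> E ! i"
| typing_App: "E \<turnstile> s \<Colon> \<sigma> \<rightarrow> \<tau> \<Longrightarrow> E \<turnstile> t \<Colon> \<sigma> \<Longrightarrow> E \<turnstile> App s t \<Colon> \<tau>"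
| typing_Lam: "\<sigma> # E \<turnstile> t \<Colon> \<tau> \<Longrightarrow> E \<turnstile> Lam \<sigma> t \<Colon> \<sigma> \<rightarrow> \<tau>"

primrec rename :: "(nat \<Rightarrow> nat) \<Rightarrow> 'a trm \<Rightarrow> 'a trm" where
  "rename r (Var i) = Var (r i)"
| "rename r (App s t) = App (rename r s) (rename r t)"
| "rename r (Lam \<sigma> t) = Lam \<sigma> (rename (case_nat 0 (\<lambda>i. Suc (r i))) t)"

abbreviation lift :: "'a trm \<Rightarrow> 'a trm" where
  "lift \<equiv> rename Suc"

text \<open>Simultaneous capture-avoiding substitution.\<close>

primrec subst :: "(nat \<Rightarrow> 'a trm) \<Rightarrow> 'a trm \<Rightarrow> 'a trm" where
  "subst f (Var i) = f i"
| "subst f (App s t) = App (subst f s) (subst f t)"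
| "subst f (Lam \<sigma> t) = Lam \<sigma> (subst (case_nat (Var 0) (\<lambda>i. lift (f i))) t)"

text \<open>\<open>\<beta>\<eta>\<close>-equality is a typed judgement, so that conversions never pass through ill-typed
  terms.\<close>

inductive beta_eta :: "'a ty list \<Rightarrow> 'a trm \<Rightarrow> 'a trm \<Rightarrow> 'a ty \<Rightarrow> bool"
    ("_ \<turnstile> _ =\<^sub>\<beta>\<^sub>\<eta> _ \<Colon> _" [51, 51, 51, 51] 50) where
  eq_refl: "E \<turnstile> t \<Colon> \<tau> \<Longrightarrow> E \<turnstile> t =\<^sub>\<beta>\<^sub>\<eta> t \<Colon> \<tau>"
| eq_sym: "E \<turnstile> s =\<^sub>\<beta>\<^sub>\<eta> t \<Colon> \<tau> \<Longrightarrow> E \<turnstile> t =\<^sub>\<beta>\<^sub>\<eta> s \<Colon> \<tau>"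
| eq_trans: "E \<turnstile> s =\<^sub>\<beta>\<^sub>\<eta> t \<Colon> \<tau> \<Longrightarrow> E \<turnstile> t =\<^sub>\<beta>\<^sub>\<eta> u \<Colon> \<tau> \<Longrightarrow> E \<turnstile> s =\<^sub>\<beta>\<^sub>\<eta> u \<Colon> \<tau>"
| eq_App: "E \<turnstile> s =\<^sub>\<beta>\<^sub>\<eta> s' \<Colon> \<sigma> \<rightarrow> \<tau> \<Longrightarrow> E \<turnstile> t =\<^sub>\<beta>\<^sub>\<eta> t' \<Colon> \<sigma> \<Longrightarrow> E \<turnstile> App s t =\<^sub>\<beta>\<^sub>\<eta> App s' t' \<Colon> \<tau>"
| eq_Lam: "\<sigma> # E \<turnstile> t =\<^sub>\<beta>\<^sub>\<eta> t' \<Colon> \<tau> \<Longrightarrow> E \<turnstile> Lam \<sigma> t =\<^sub>\<beta>\<^sub>\<eta> Lam \<sigma> t' \<Colon> \<sigma> \<rightarrow> \<tau>"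
| eq_beta: "\<sigma> # E \<turnstile> s \<Colon> \<tau> \<Longrightarrow> E \<turnstile> t \<Colon> \<sigma> \<Longrightarrow>
    E \<turnstile> App (Lam \<sigma> s) t =\<^sub>\<beta>\<^sub>\<eta> subst (case_nat t Var) s \<Colon> \<tau>"
| eq_eta: "E \<turnstile> t \<Colon> \<sigma> \<rightarrow> \<tau> \<Longrightarrow> E \<turnstile> Lam \<sigma> (App (lift t) (Var 0)) =\<^sub>\<beta>\<^sub>\<eta> t \<Colon> \<sigma> \<rightarrow> \<tau>"

primrec occurrences :: "nat \<Rightarrow> 'a trm \<Rightarrow> nat" where
  "occurrences i (Var j) = (if i = j then 1 else 0)"
| "occurrences i (App s t) = occurrences i s + occurrences i t"
| "occurrences i (Lam \<sigma> t) = occurrences (Suc i) t"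

primrec bound_affine :: "'a trm \<Rightarrow> bool" where
  "bound_affine (Var i) \<longleftrightarrow> True"
| "bound_affine (App s t) \<longleftrightarrow> bound_affine s \<and> bound_affine t"
| "bound_affine (Lam \<sigma> t) \<longleftrightarrow> occurrences 0 t \<le> 1 \<and> bound_affine t"

definition affine :: "'a trm \<Rightarrow> bool" where
  "affine t \<longleftrightarrow> (\<forall>i. occurrences i t \<le> 1) \<and> bound_affine t"

section \<open>Retractions\<close>

text \<open>The distinguished variable \<open>x : \<rho>\<close> is variable \<open>0\<close> of the environment \<open>\<rho> # E\<close>. The decoder
  is typed in \<open>E\<close> and lifted over \<open>x\<close>, which therefore does not occur in it.\<close>

definition retraction_via ::
    "'a ty list \<Rightarrow> 'a trm \<Rightarrow> 'a trm \<Rightarrow> 'a ty \<Rightarrow> 'a ty \<Rightarrow> bool" where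
  "retraction_via E C D \<rho> \<tau> \<longleftrightarrow>
     (\<rho> # E \<turnstile> C \<Colon> \<tau>) \<and> (E \<turnstile> D \<Colon> \<tau> \<rightarrow> \<rho>) \<and> (\<rho> # E \<turnstile> App (lift D) C =\<^sub>\<beta>\<^sub>\<eta> Var 0 \<Colon> \<rho>)"

definition affine_retract :: "'a ty \<Rightarrow> 'a ty \<Rightarrow> bool" where
  "affine_retract \<rho> \<tau> \<longleftrightarrow> (\<exists>E C D. retraction_via E C D \<rho> \<tau> \<and> affine C \<and> affine D)"

end

theory Submission
  imports Defs
begin

text \<open>For the first part, rule (D) is derived in LPS by adding the premises one at a time:
  \<open>\<Delta> \<rightarrow> a \<unlhd> ((\<Delta> \<rightarrow> a) \<rightarrow> a) \<rightarrow> a\<close> is an instance of (A4), and since (R2) is covariant in both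
  arguments, \<open>\<Delta> \<rightarrow> a \<unlhd> \<sigma>\<close> turns the right-hand side into \<open>(\<sigma> \<rightarrow> a) \<rightarrow> a\<close> and then, by (A2), into
  \<open>(\<Sigma> \<rightarrow> \<sigma> \<rightarrow> a) \<rightarrow> a\<close>. For the second part, affine retractions are closed under the rules of LPS;
  the free variables of two retractions are made disjoint before these are combined. Since (R1) and
  (R2) preserve affine retractions, types related by \<open>\<sim>\<close> are retracts of each other as soon as
  this holds for a single swap of arguments.\<close>

section \<open>From CF to LPS\<close>

lemma foldr_Arrow_swap_iso: "foldr Arrow (ts @ [\<tau>]) \<rho> \<sim> \<tau> \<rightarrow> foldr Arrow ts \<rho>"
proof (induction ts)
  case Nil
  show ?case by (simp add: iso_refl)
next
  case (Cons \<sigma> ts)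
  have "\<sigma> \<rightarrow> foldr Arrow (ts @ [\<tau>]) \<rho> \<sim> \<sigma> \<rightarrow> \<tau> \<rightarrow> foldr Arrow ts \<rho>"
    by (rule iso_arrow[OF iso_refl Cons.IH])
  then show ?case
    using iso_trans iso_swap by fastforce
qed

text \<open>The first type of \<open>ts\<close> occurs somewhere in \<open>us\<close>. Swaps carry
  it past the types before it to the front, and the remaining lists again have equal
  multisets.\<close>

lemma foldr_Arrow_perm_iso:
  "mset ts = mset us \<Longrightarrow> foldr Arrow ts \<rho> \<sim> foldr Arrow us \<rho>"
proof (induction ts arbitrary: us)
  case Nil
  then show ?case by (simp add: iso_refl)
next
  case (Cons \<tau> ts)
  then have "\<tau> \<in> set us"
    by (metis list.set_intros(1) mset_eq_setD)
  then obtain vs ws where us: "us = vs @ \<tau> # ws"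
    by (meson split_list)
  with Cons.prems have "mset ts = mset (vs @ ws)"
    by simp
  then have "\<tau> \<rightarrow> foldr Arrow ts \<rho> \<sim> \<tau> \<rightarrow> foldr Arrow vs (foldr Arrow ws \<rho>)"
    using Cons.IH[of "vs @ ws"] by (auto intro: iso_arrow iso_refl)
  moreover have "\<tau> \<rightarrow> foldr Arrow vs (foldr Arrow ws \<rho>) \<sim> foldr Arrow us \<rho>"
    using foldr_Arrow_swap_iso[of vs \<tau> "foldr Arrow ws \<rho>"] us by (auto intro: iso_sym)
  ultimately show ?case
    by (auto intro: iso_trans)
qed

text \<open>The chosen list depends on \<open>\<Sigma>\<close> alone, so one \<open>ts\<close>
  serves every target \<open>\<rho>\<close>. Nested prefixes thus become a single
  \<open>foldr\<close> over an appended list.\<close>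

lemma arrows_obtain_list:
  obtains ts where "mset ts = \<Sigma>" "\<And>\<rho>. \<Sigma> \<Rrightarrow> \<rho> = foldr Arrow ts \<rho>"
  using someI_ex[OF ex_mset[of \<Sigma>]] unfolding arrows_def by blast

lemma arrows_iso_foldr:
  assumes "mset ts = \<Sigma>"
  shows "\<Sigma> \<Rrightarrow> \<rho> \<sim> foldr Arrow ts \<rho>"
  using assms by (metis arrows_obtain_list foldr_Arrow_perm_iso)

lemma arrows_empty: "{#} \<Rrightarrow> \<rho> = \<rho>"
  by (simp add: arrows_def)

lemma arrows_union_iso: "(\<Sigma> + \<Delta>) \<Rrightarrow> \<rho> \<sim> \<Sigma> \<Rrightarrow> \<Delta> \<Rrightarrow> \<rho>"
proof -
  obtain ts where ts: "mset ts = \<Sigma>" "\<And>\<rho>. \<Sigma> \<Rrightarrow> \<rho> = foldr Arrow ts \<rho>"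
    using arrows_obtain_list by blast
  obtain us where us: "mset us = \<Delta>" "\<And>\<rho>. \<Delta> \<Rrightarrow> \<rho> = foldr Arrow us \<rho>"
    using arrows_obtain_list by blast
  show ?thesis
    using arrows_iso_foldr[of "ts @ us" "\<Sigma> + \<Delta>" \<rho>] ts us by simp
qed

lemma arrows_single: "{#\<tau>#} \<Rrightarrow> \<rho> = \<tau> \<rightarrow> \<rho>"
  by (simp add: arrows_def)

lemma arrows_commute_iso: "\<Sigma> \<Rrightarrow> \<Delta> \<Rrightarrow> \<rho> \<sim> \<Delta> \<Rrightarrow> \<Sigma> \<Rrightarrow> \<rho>"
  by (metis add.commute arrows_union_iso iso_sym iso_trans)

lemma head_arrows: "head (\<Sigma> \<Rrightarrow> \<rho>) = head \<rho>"
proof -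
  have "head (foldr Arrow ts \<rho>) = head \<rho>" for ts
    by (induction ts) auto
  then show ?thesis by (simp add: arrows_def)
qed

lemma LPS_arrows_mono:
  assumes "LPS \<rho> \<tau>"
  shows "LPS (\<Sigma> \<Rrightarrow> \<rho>) (\<Sigma> \<Rrightarrow> \<tau>)"
proof -
  have "LPS (foldr Arrow ts \<rho>) (foldr Arrow ts \<tau>)" for ts
    by (induction ts) (auto intro: assms LPS_A1 LPS_R2)
  then show ?thesis by (simp add: arrows_def)
qed

lemma LPS_arrows_weaken: "LPS \<rho> (\<Sigma> \<Rrightarrow> \<rho>)"
proof -
  have "LPS \<rho> (foldr Arrow ts \<rho>)" for ts
    by (induction ts) (auto intro: LPS_A1 LPS_A2 LPS_R1)
  then show ?thesis by (simp add: arrows_def)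
qed

lemma iso_imp_LPS: "\<sigma> \<sim> \<tau> \<Longrightarrow> LPS \<sigma> \<tau>"
  using LPS_A1 LPS_iso iso_refl by blast

lemma LPS_double_negation:
  assumes "LPS (\<Delta> \<Rrightarrow> Atom a) \<sigma>"
  shows "LPS (\<Delta> \<Rrightarrow> Atom a) ((\<Sigma> \<Rrightarrow> \<sigma> \<rightarrow> Atom a) \<rightarrow> Atom a)"
proof -
  have "LPS (\<Delta> \<Rrightarrow> Atom a) (((\<Delta> \<Rrightarrow> Atom a) \<rightarrow> Atom a) \<rightarrow> Atom a)"
    by (rule LPS_A4) (simp add: head_arrows)
  moreover have "LPS ((\<Delta> \<Rrightarrow> Atom a) \<rightarrow> Atom a) (\<Sigma> \<Rrightarrow> \<sigma> \<rightarrow> Atom a)"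
    using LPS_R1[OF LPS_R2[OF assms LPS_A1] LPS_arrows_weaken] .
  ultimately show ?thesis
    using LPS_A1 LPS_R1 LPS_R2 by blast
qed

text \<open>For rule (D), \<open>\<gamma> i\<close> is
  \<open>\<Sigma> i \<Rrightarrow> \<sigma> i \<rightarrow> Atom a\<close>. The premises can be
  chained because all of them end in \<open>a\<close> on both sides: with \<open>\<Delta> n\<close>
  outermost, the induction hypothesis rewrites the tail behind it. Exchanging the prefixes then puts
  \<open>\<Delta> n\<close> next to \<open>a\<close>, where premise \<open>n\<close>
  applies.\<close>

lemma LPS_arrows_sum:
  fixes n :: nat
  assumes "\<And>i. i < n \<Longrightarrow> LPS (\<Delta> i \<Rrightarrow> Atom a) (\<gamma> i \<rightarrow> Atom a)"
  shows "LPS ((\<Sum>i<n. \<Delta> i) \<Rrightarrow> Atom a) ({# \<gamma> i. i \<in># mset_set {..<n} #} \<Rrightarrow> Atom a)"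
  using assms
proof (induction n)
  case 0
  show ?case by (simp add: arrows_empty LPS_A1)
next
  case (Suc n)
  let ?\<Delta> = "\<Sum>i<n. \<Delta> i" and ?\<Gamma> = "{# \<gamma> i. i \<in># mset_set {..<n} #}"
  have "LPS ((?\<Delta> + \<Delta> n) \<Rrightarrow> Atom a) (\<Delta> n \<Rrightarrow> ?\<Delta> \<Rrightarrow> Atom a)"
    by (rule iso_imp_LPS) (metis add.commute arrows_union_iso)
  moreover have "LPS (\<Delta> n \<Rrightarrow> ?\<Delta> \<Rrightarrow> Atom a) (\<Delta> n \<Rrightarrow> ?\<Gamma> \<Rrightarrow> Atom a)"
    by (intro LPS_arrows_mono Suc.IH Suc.prems) simp
  moreover have "LPS (\<Delta> n \<Rrightarrow> ?\<Gamma> \<Rrightarrow> Atom a) (?\<Gamma> \<Rrightarrow> \<Delta> n \<Rrightarrow> Atom a)"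
    by (rule iso_imp_LPS[OF arrows_commute_iso])
  moreover have "LPS (?\<Gamma> \<Rrightarrow> \<Delta> n \<Rrightarrow> Atom a) (?\<Gamma> \<Rrightarrow> \<gamma> n \<rightarrow> Atom a)"
    by (intro LPS_arrows_mono Suc.prems) simp
  moreover have "?\<Gamma> \<Rrightarrow> \<gamma> n \<rightarrow> Atom a \<sim> add_mset (\<gamma> n) ?\<Gamma> \<Rrightarrow> Atom a"
    using arrows_union_iso[of ?\<Gamma> "{#\<gamma> n#}" "Atom a"] by (simp add: arrows_single iso_sym)
  ultimately have "LPS ((?\<Delta> + \<Delta> n) \<Rrightarrow> Atom a) (add_mset (\<gamma> n) ?\<Gamma> \<Rrightarrow> Atom a)"
    by (meson LPS_R1 iso_imp_LPS)
  then show ?case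
    by (simp add: lessThan_Suc add.commute)
qed

lemma CF_imp_LPS: "CF \<sigma> \<tau> \<Longrightarrow> LPS \<sigma> \<tau>"
proof (induction rule: CF.induct)
  case (CF_iso \<rho> \<tau> \<rho>' \<tau>')
  then show ?case using LPS_iso by blast
next
  case (CF_Axiom a)
  show ?case by (rule LPS_A1)
next
  case (CF_H \<sigma> \<sigma>' \<tau> \<tau>')
  then show ?case by (simp add: LPS_R2)
next
  case (CF_N \<rho> \<tau> \<Sigma>)
  then show ?case using LPS_R1 LPS_arrows_weaken by blast
next
  case (CF_D n \<Delta> a \<sigma> \<Sigma>)
  then show ?case by (intro LPS_arrows_sum LPS_double_negation) blast
qed

section \<open>Renaming, substitution and typed conversion\<close>

text \<open>Arbitrary functions on indices keep the induction going through binders: the only thing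
  to check there is that extending a function under a binder commutes with composition. The next
  three lemmas have the same shape.\<close>

lemma rename_rename: "rename r (rename q t) = rename (\<lambda>i. r (q i)) t"
proof (induction t arbitrary: r q)
  case (Lam \<sigma> t)
  have "(\<lambda>i. case_nat 0 (\<lambda>i. Suc (r i)) (case_nat 0 (\<lambda>i. Suc (q i)) i)) =
      case_nat 0 (\<lambda>i. Suc (r (q i)))"
    by (auto split: nat.split)
  then show ?case by (simp add: Lam)
qed auto

lemma subst_rename: "subst f (rename q t) = subst (\<lambda>i. f (q i)) t"
proof (induction t arbitrary: f q)
  case (Lam \<sigma> t)
  have "(\<lambda>i. case_nat (Var 0) (\<lambda>i. lift (f i)) (case_nat 0 (\<lambda>i. Suc (q i)) i)) =
      case_nat (Var 0) (\<lambda>i. lift (f (q i)))"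
    by (auto split: nat.split)
  then show ?case by (simp add: Lam)
qed auto

lemma rename_subst: "rename r (subst f t) = subst (\<lambda>i. rename r (f i)) t"
proof (induction t arbitrary: f r)
  case (Lam \<sigma> t)
  have "(\<lambda>i. rename (case_nat 0 (\<lambda>i. Suc (r i))) (case_nat (Var 0) (\<lambda>i. lift (f i)) i)) =
      case_nat (Var 0) (\<lambda>i. lift (rename r (f i)))"
    by (auto simp: rename_rename split: nat.split)
  then show ?case by (simp add: Lam)
qed auto

lemma subst_Var_rename: "subst (\<lambda>i. Var (r i)) t = rename r t"
proof (induction t arbitrary: r)
  case (Lam \<sigma> t)
  have eq: "case_nat (Var 0) (\<lambda>i. lift (Var (r i))) = (\<lambda>i. Var (case_nat 0 (\<lambda>i. Suc (r i)) i))"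
    by (auto split: nat.split)
  show ?case by (simp only: subst.simps(3) rename.simps(3) eq Lam)
qed auto

lemma rename_id: "rename (\<lambda>i. i) t = t"
proof (induction t)
  case (Lam \<sigma> t)
  have "case_nat 0 Suc = (\<lambda>i. i)"
    by (auto split: nat.split)
  then show ?case by (simp add: Lam)
qed auto

lemma subst_Var: "subst Var t = t"
  using subst_Var_rename[of "\<lambda>i. i" t] by (simp add: rename_id)

lemmas trm_simps = rename_rename subst_rename subst_Var_rename subst_Var rename_id

section \<open>Typing and conversion under renaming\<close>

definition renaming :: "(nat \<Rightarrow> nat) \<Rightarrow> 'a ty list \<Rightarrow> 'a ty list \<Rightarrow> bool" where
  "renaming r E F \<longleftrightarrow> (\<forall>i < length E. r i < length F \<and> F ! r i = E ! i)"

lemma renaming_Cons: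
  "renaming r E F \<Longrightarrow> renaming (case_nat 0 (\<lambda>i. Suc (r i))) (\<sigma> # E) (\<sigma> # F)"
  by (auto simp: renaming_def nth_Cons' split: nat.split)

lemma renaming_Suc: "renaming Suc E (\<sigma> # E)"
  by (simp add: renaming_def)

lemma typing_rename: "E \<turnstile> t \<Colon> \<tau> \<Longrightarrow> renaming r E F \<Longrightarrow> F \<turnstile> rename r t \<Colon> \<tau>"
proof (induction arbitrary: r F rule: typing.induct)
  case (typing_Var i E)
  then show ?case
    by (metis renaming_def rename.simps(1) typing.typing_Var)
next
  case (typing_App E s \<sigma> \<tau> t)
  then show ?case by (auto intro: typing.typing_App[where \<sigma> = \<sigma>])
next
  case (typing_Lam \<sigma> E t \<tau>)
  then show ?case by (auto intro: typing.typing_Lam renaming_Cons)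
qed

lemma typing_lift: "E \<turnstile> t \<Colon> \<tau> \<Longrightarrow> \<sigma> # E \<turnstile> lift t \<Colon> \<tau>"
  by (rule typing_rename[OF _ renaming_Suc])

lemma typing_VarI: "i < length E \<Longrightarrow> E ! i = \<tau> \<Longrightarrow> E \<turnstile> Var i \<Colon> \<tau>"
  using typing_Var by blast

lemmas typing_intros = typing_App typing_Lam typing_VarI typing_lift

lemma beta_eta_rename:
  "E \<turnstile> s =\<^sub>\<beta>\<^sub>\<eta> t \<Colon> \<tau> \<Longrightarrow> renaming r E F \<Longrightarrow> F \<turnstile> rename r s =\<^sub>\<beta>\<^sub>\<eta> rename r t \<Colon> \<tau>"
proof (induction arbitrary: r F rule: beta_eta.induct)
  case (eq_refl E t \<tau>)
  then show ?case by (auto intro: beta_eta.eq_refl typing_rename)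
next
  case (eq_sym E s t \<tau>)
  then show ?case by (auto intro: beta_eta.eq_sym)
next
  case (eq_trans E s t \<tau> u)
  then show ?case by (blast intro: beta_eta.eq_trans)
next
  case (eq_App E s s' \<sigma> \<tau> t t')
  then show ?case by (auto intro: beta_eta.eq_App[where \<sigma> = \<sigma>])
next
  case (eq_Lam \<sigma> E t t' \<tau>)
  then show ?case by (auto intro: beta_eta.eq_Lam renaming_Cons)
next
  case (eq_beta \<sigma> E s \<tau> t)
  let ?r = "case_nat 0 (\<lambda>i. Suc (r i))"
  have "F \<turnstile> App (Lam \<sigma> (rename ?r s)) (rename r t)
      =\<^sub>\<beta>\<^sub>\<eta> subst (case_nat (rename r t) Var) (rename ?r s) \<Colon> \<tau>"
    using eq_beta by (auto intro: beta_eta.eq_beta typing_rename renaming_Cons)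
  \<comment> \<open>Contracting the redex before or after renaming substitutes the same terms for
    the variables of \<open>s\<close>.\<close>
  moreover have "(\<lambda>i. case_nat (rename r t) Var (?r i)) = (\<lambda>i. rename r (case_nat t Var i))"
    by (auto split: nat.split)
  ultimately show ?case
    by (simp add: subst_rename rename_subst)
next
  case (eq_eta E t \<sigma> \<tau>)
  then have "F \<turnstile> Lam \<sigma> (App (lift (rename r t)) (Var 0)) =\<^sub>\<beta>\<^sub>\<eta> rename r t \<Colon> \<sigma> \<rightarrow> \<tau>"
    by (auto intro: beta_eta.eq_eta typing_rename)
  then show ?case by (simp add: rename_rename)
qed

section \<open>Derived conversion rules: beta steps and extensionality\<close>

declare eq_trans [trans]

lemma beta_eqI:
  assumes "\<sigma> # E \<turnstile> s \<Colon> \<tau>" "E \<turnstile> t \<Colon> \<sigma>" "subst (case_nat t Var) s = u"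
  shows "E \<turnstile> App (Lam \<sigma> s) t =\<^sub>\<beta>\<^sub>\<eta> u \<Colon> \<tau>"
  using eq_beta assms by blast

text \<open>The fourth premise types the term left by the first contraction. It is checked for the
  concrete terms at hand, in place of a general statement on typing under substitution.\<close>

lemma beta2_eqI:
  assumes "\<rho> # \<sigma> # E \<turnstile> s \<Colon> \<tau>" "E \<turnstile> t \<Colon> \<sigma>" "E \<turnstile> u \<Colon> \<rho>"
    and "\<rho> # E \<turnstile> subst (case_nat (Var 0) (\<lambda>i. lift (case_nat t Var i))) s \<Colon> \<tau>"
    and "subst (case_nat u Var) (subst (case_nat (Var 0) (\<lambda>i. lift (case_nat t Var i))) s) = v"
  shows "E \<turnstile> App (App (Lam \<sigma> (Lam \<rho> s)) t) u =\<^sub>\<beta>\<^sub>\<eta> v \<Colon> \<tau>"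
proof -
  have "E \<turnstile> App (Lam \<sigma> (Lam \<rho> s)) t
      =\<^sub>\<beta>\<^sub>\<eta> Lam \<rho> (subst (case_nat (Var 0) (\<lambda>i. lift (case_nat t Var i))) s) \<Colon> \<rho> \<rightarrow> \<tau>"
    using assms by (auto intro!: beta_eqI typing_intros)
  then show ?thesis
    using assms by (blast intro: eq_trans eq_App eq_refl beta_eqI)
qed

text \<open>The eta-expansions of \<open>s\<close> and \<open>t\<close> have convertible bodies, and
  \<open>eq_Lam\<close> joins them.\<close>

lemma eq_ext:
  assumes "E \<turnstile> s \<Colon> \<sigma> \<rightarrow> \<tau>" "E \<turnstile> t \<Colon> \<sigma> \<rightarrow> \<tau>"
    and "\<sigma> # E \<turnstile> App (lift s) (Var 0) =\<^sub>\<beta>\<^sub>\<eta> App (lift t) (Var 0) \<Colon> \<tau>"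
  shows "E \<turnstile> s =\<^sub>\<beta>\<^sub>\<eta> t \<Colon> \<sigma> \<rightarrow> \<tau>"
  using assms by (blast intro: eq_trans eq_sym eq_eta eq_Lam)

section \<open>Occurrences\<close>

lemma inj_case_nat: "inj r \<Longrightarrow> inj (case_nat 0 (\<lambda>i. Suc (r i)))"
  by (rule injI) (auto split: nat.splits dest: injD)

text \<open>Injectivity keeps distinct variables apart, so that their counts are not added
  up.\<close>

lemma occurrences_rename: "inj r \<Longrightarrow> occurrences (r i) (rename r t) = occurrences i t"
proof (induction t arbitrary: r i)
  case (App s t)
  show ?case
    by (simp only: rename.simps occurrences.simps App.IH[OF App.prems])
next
  case (Lam \<sigma> t)
  show ?case
    using Lam.IH[OF inj_case_nat[OF Lam.prems], of "Suc i"] by simp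
qed (auto simp: inj_eq)

lemma occurrences_rename_notin: "j \<notin> range r \<Longrightarrow> occurrences j (rename r t) = 0"
proof (induction t arbitrary: r j)
  case (Lam \<sigma> t)
  have "Suc j \<notin> range (case_nat 0 (\<lambda>i. Suc (r i)))"
    using Lam.prems by (auto split: nat.splits)
  then show ?case by (simp add: Lam.IH)
qed auto

lemma occurrences_lift [simp]:
  "occurrences 0 (lift t) = 0"
  "occurrences (Suc i) (lift t) = occurrences i t"
  by (simp_all add: occurrences_rename_notin occurrences_rename[of Suc])

lemma bound_affine_rename: "inj r \<Longrightarrow> bound_affine (rename r t) = bound_affine t"
proof (induction t arbitrary: r)
  case (Lam \<sigma> t)
  then show ?case
    using occurrences_rename[OF inj_case_nat[OF Lam.prems], of 0 t] by (simp add: inj_case_nat)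
qed auto

lemma affine_rename:
  assumes "inj r" "affine t"
  shows "affine (rename r t)"
  unfolding affine_def
proof (intro conjI allI)
  show "occurrences j (rename r t) \<le> 1" for j
  proof (cases "j \<in> range r")
    case True
    then obtain i where "j = r i" by blast
    then have "occurrences j (rename r t) = occurrences i t"
      using occurrences_rename[OF assms(1)] by blast
    then show ?thesis
      using assms(2) by (simp add: affine_def)
  qed (simp add: occurrences_rename_notin)
  show "bound_affine (rename r t)"
    using assms by (simp add: affine_def bound_affine_rename)
qed

lemma bound_affine_lift [simp]: "bound_affine (lift t) = bound_affine t"
  by (simp add: bound_affine_rename)

text \<open>This turns the length of an environment into a bound on free variables, so that shifting
  by this length separates two terms.\<close>

lemma occurrences_typed: "E \<turnstile> t \<Colon> \<tau> \<Longrightarrow> length E \<le> i \<Longrightarrow> occurrences i t = 0"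
  by (induction arbitrary: i rule: typing.induct) auto

section \<open>Closure properties of affine retractions\<close>

text \<open>Here the coder is a function, rather than a term with a distinguished free variable, so that
  coder and decoder live in the same environment.\<close>

definition affine_pair :: "'a ty list \<Rightarrow> 'a trm \<Rightarrow> 'a trm \<Rightarrow> 'a ty \<Rightarrow> 'a ty \<Rightarrow> bool" where
  "affine_pair E c d \<sigma> \<tau> \<longleftrightarrow>
     (E \<turnstile> c \<Colon> \<sigma> \<rightarrow> \<tau>) \<and> (E \<turnstile> d \<Colon> \<tau> \<rightarrow> \<sigma>) \<and>
     (\<sigma> # E \<turnstile> App (lift d) (App (lift c) (Var 0)) =\<^sub>\<beta>\<^sub>\<eta> Var 0 \<Colon> \<sigma>) \<and> affine c \<and> affine d"

text \<open>Applying \<open>c\<close> to the distinguished variable gives the coder as a term. This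
  stays affine because \<open>lift c\<close> does not contain that variable.\<close>

lemma affine_pair_imp_affine_retract:
  assumes "affine_pair E c d \<sigma> \<tau>"
  shows "affine_retract \<sigma> \<tau>"
proof -
  have "affine (App (lift c) (Var 0))"
    unfolding affine_def
  proof (intro conjI allI)
    show "occurrences i (App (lift c) (Var 0)) \<le> 1" for i
      using assms by (cases i) (auto simp: affine_pair_def affine_def)
  qed (use assms in \<open>simp add: affine_pair_def affine_def\<close>)
  moreover have "\<sigma> # E \<turnstile> App (lift c) (Var 0) \<Colon> \<tau>"
    using assms by (auto simp: affine_pair_def intro!: typing_intros)
  ultimately have "retraction_via E (App (lift c) (Var 0)) d \<sigma> \<tau> \<and>
      affine (App (lift c) (Var 0)) \<and> affine d"
    using assms by (simp add: affine_pair_def retraction_via_def)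
  then show ?thesis
    unfolding affine_retract_def by blast
qed

lemma affine_pair_rename:
  assumes "affine_pair E c d \<sigma> \<tau>" "renaming r E F" "inj r"
  shows "affine_pair F (rename r c) (rename r d) \<sigma> \<tau>"
proof -
  let ?r = "case_nat 0 (\<lambda>i. Suc (r i))"
  \<comment> \<open>\<open>?r\<close> fixes the distinguished variable and acts as \<open>r\<close>
    on the others, so the conversion is transported as a whole.\<close>
  have "\<sigma> # F \<turnstile> rename ?r (App (lift d) (App (lift c) (Var 0))) =\<^sub>\<beta>\<^sub>\<eta> rename ?r (Var 0) \<Colon> \<sigma>"
    using assms by (auto simp only: affine_pair_def intro: beta_eta_rename renaming_Cons)
  then show ?thesis
    using assms by (auto simp: affine_pair_def rename_rename intro: typing_rename affine_rename)
qed

text \<open>The conversion for the distinguished variable is instantiated without substituting into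
  a derivation: both sides are abstracted by \<open>eq_Lam\<close>, applied to \<open>s\<close>, and
  contracted.\<close>

lemma affine_pair_app:
  assumes "affine_pair E c d \<sigma> \<tau>" "E \<turnstile> s \<Colon> \<sigma>"
  shows "E \<turnstile> App d (App c s) =\<^sub>\<beta>\<^sub>\<eta> s \<Colon> \<sigma>"
proof -
  have ty: "E \<turnstile> c \<Colon> \<sigma> \<rightarrow> \<tau>" "E \<turnstile> d \<Colon> \<tau> \<rightarrow> \<sigma>"
    using assms by (auto simp: affine_pair_def)
  have "E \<turnstile> App (Lam \<sigma> (App (lift d) (App (lift c) (Var 0)))) s =\<^sub>\<beta>\<^sub>\<eta> App d (App c s) \<Colon> \<sigma>"
    using ty assms(2) by (intro beta_eqI typing_intros) (auto simp: trm_simps)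
  moreover have "E \<turnstile> App (Lam \<sigma> (App (lift d) (App (lift c) (Var 0)))) s
      =\<^sub>\<beta>\<^sub>\<eta> App (Lam \<sigma> (Var 0)) s \<Colon> \<sigma>"
    using assms by (auto simp: affine_pair_def intro!: eq_App eq_Lam eq_refl)
  moreover have "E \<turnstile> App (Lam \<sigma> (Var 0)) s =\<^sub>\<beta>\<^sub>\<eta> s \<Colon> \<sigma>"
    using assms(2) by (auto intro!: beta_eqI typing_intros)
  ultimately show ?thesis
    by (meson eq_sym eq_trans)
qed

lemma affine_pair_lift: "affine_pair E c d \<sigma> \<tau> \<Longrightarrow> affine_pair (\<rho> # E) (lift c) (lift d) \<sigma> \<tau>"
  by (rule affine_pair_rename[OF _ renaming_Suc]) simp_all

definition fun_retract :: "'a ty \<Rightarrow> 'a ty \<Rightarrow> bool" where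
  "fun_retract \<sigma> \<tau> \<longleftrightarrow> (\<exists>E c d. affine_pair E c d \<sigma> \<tau>)"

text \<open>The environments are concatenated and the second pair is shifted past the first. Coder
  and decoder of one pair may still share variables, since each is affine on its own. Only terms of
  different pairs get combined later: coder with coder for (R1), coder with decoder for
  (R2).\<close>

lemma fun_retract_disjoint:
  assumes "fun_retract \<sigma> \<tau>" "fun_retract \<sigma>' \<tau>'"
  obtains E c d c' d' where "affine_pair E c d \<sigma> \<tau>" "affine_pair E c' d' \<sigma>' \<tau>'"
    "\<And>i. occurrences i c = 0 \<and> occurrences i d = 0 \<or> occurrences i c' = 0 \<and> occurrences i d' = 0"
proof -
  obtain E c d where 1: "affine_pair E c d \<sigma> \<tau>"
    using assms(1) fun_retract_def by blast
  obtain E' c' d' where 2: "affine_pair E' c' d' \<sigma>' \<tau>'"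
    using assms(2) fun_retract_def by blast
  let ?r = "\<lambda>i. length E + i"
  have "renaming (\<lambda>i. i) E (E @ E')" "renaming ?r E' (E @ E')"
    by (auto simp: renaming_def nth_append)
  \<comment> \<open>Renaming by the identity weakens the environment of the first pair.\<close>
  then have "affine_pair (E @ E') (rename (\<lambda>i. i) c) (rename (\<lambda>i. i) d) \<sigma> \<tau>"
    and "affine_pair (E @ E') (rename ?r c') (rename ?r d') \<sigma>' \<tau>'"
    by (auto intro!: affine_pair_rename[OF 1] affine_pair_rename[OF 2])
  moreover have "occurrences i c = 0 \<and> occurrences i d = 0 \<or>
      occurrences i (rename ?r c') = 0 \<and> occurrences i (rename ?r d') = 0" for i
  proof (cases "i < length E")
    case True
    then have "i \<notin> range ?r" by auto
    then show ?thesis by (simp add: occurrences_rename_notin)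
  next
    case False
    then show ?thesis
      using 1 by (auto simp: affine_pair_def intro: occurrences_typed)
  qed
  ultimately show ?thesis
    using that by (simp add: rename_id)
qed

section \<open>Transitivity, for (R1)\<close>

definition compose :: "'a ty \<Rightarrow> 'a trm \<Rightarrow> 'a trm \<Rightarrow> 'a trm" where
  "compose \<sigma> t s = Lam \<sigma> (App (lift t) (App (lift s) (Var 0)))"

lemma typing_compose:
  "E \<turnstile> s \<Colon> \<sigma> \<rightarrow> \<tau> \<Longrightarrow> E \<turnstile> t \<Colon> \<tau> \<rightarrow> \<rho> \<Longrightarrow> E \<turnstile> compose \<sigma> t s \<Colon> \<sigma> \<rightarrow> \<rho>"
  unfolding compose_def by (rule typing_intros | assumption | simp)+

lemma rename_compose: "rename r (compose \<sigma> t s) = compose \<sigma> (rename r t) (rename r s)"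
  by (simp add: compose_def trm_simps)

lemma compose_app:
  assumes "E \<turnstile> s \<Colon> \<sigma> \<rightarrow> \<tau>" "E \<turnstile> t \<Colon> \<tau> \<rightarrow> \<rho>" "E \<turnstile> u \<Colon> \<sigma>"
  shows "E \<turnstile> App (compose \<sigma> t s) u =\<^sub>\<beta>\<^sub>\<eta> App t (App s u) \<Colon> \<rho>"
  unfolding compose_def using assms
  by (intro beta_eqI typing_intros) (auto simp: trm_simps)

text \<open>The lifts avoid the bound variable, which therefore occurs once. A free variable occurs
  in at most one of the two terms.\<close>

lemma affine_compose:
  assumes "affine s" "affine t" "\<And>i. occurrences i s = 0 \<or> occurrences i t = 0"
  shows "affine (compose \<sigma> t s)"
  unfolding affine_def
proof (intro conjI allI)
  show "occurrences i (compose \<sigma> t s) \<le> 1" for i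
    using assms(1,2) assms(3)[of i] by (auto simp: affine_def compose_def)
qed (use assms in \<open>simp add: affine_def compose_def\<close>)

text \<open>The composite applied to \<open>x\<close> is \<open>d (d' (c' (c x)))\<close>: the inner
  pair cancels first, then the outer one.\<close>

lemma fun_retract_trans:
  assumes "fun_retract \<sigma> \<tau>" "fun_retract \<tau> \<rho>"
  shows "fun_retract \<sigma> \<rho>"
proof -
  obtain E c d c' d' where p: "affine_pair E c d \<sigma> \<tau>" "affine_pair E c' d' \<tau> \<rho>"
    and dis: "\<And>i. occurrences i c = 0 \<and> occurrences i d = 0 \<or>
      occurrences i c' = 0 \<and> occurrences i d' = 0"
    using fun_retract_disjoint[OF assms] by blast
  have ty: "E \<turnstile> c \<Colon> \<sigma> \<rightarrow> \<tau>" "E \<turnstile> d \<Colon> \<tau> \<rightarrow> \<sigma>" "E \<turnstile> c' \<Colon> \<tau> \<rightarrow> \<rho>" "E \<turnstile> d' \<Colon> \<rho> \<rightarrow> \<tau>"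
    using p by (auto simp: affine_pair_def)
  have aff: "affine c" "affine d" "affine c'" "affine d'"
    using p by (auto simp: affine_pair_def)
  have dis': "occurrences i c = 0 \<or> occurrences i c' = 0" "occurrences i d' = 0 \<or> occurrences i d = 0" for i
    using dis[of i] by auto
  let ?E = "\<sigma> # E"
  have x: "?E \<turnstile> Var 0 \<Colon> \<sigma>"
    by (simp add: typing_VarI)
  note typl = ty[THEN typing_lift[where \<sigma> = \<sigma>]]
  note pl = p[THEN affine_pair_lift[where \<rho> = \<sigma>]]
  have "?E \<turnstile> App (compose \<rho> (lift d) (lift d')) (App (compose \<sigma> (lift c') (lift c)) (Var 0))
      =\<^sub>\<beta>\<^sub>\<eta> App (compose \<rho> (lift d) (lift d')) (App (lift c') (App (lift c) (Var 0))) \<Colon> \<sigma>"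
    by (rule eq_App[OF eq_refl compose_app]) (rule typing_compose typl x)+
  also have "?E \<turnstile> App (compose \<rho> (lift d) (lift d')) (App (lift c') (App (lift c) (Var 0)))
      =\<^sub>\<beta>\<^sub>\<eta> App (lift d) (App (lift d') (App (lift c') (App (lift c) (Var 0)))) \<Colon> \<sigma>"
    by (rule compose_app) (rule typl typing_App x)+
  also have "?E \<turnstile> App (lift d) (App (lift d') (App (lift c') (App (lift c) (Var 0))))
      =\<^sub>\<beta>\<^sub>\<eta> App (lift d) (App (lift c) (Var 0)) \<Colon> \<sigma>"
    by (rule eq_App[OF eq_refl affine_pair_app[OF pl(2)]]) (rule typl typing_App[OF _ x])+
  also have "?E \<turnstile> App (lift d) (App (lift c) (Var 0)) =\<^sub>\<beta>\<^sub>\<eta> Var 0 \<Colon> \<sigma>"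
    by (intro affine_pair_app[OF pl(1)] x)
  finally have eq:
    "?E \<turnstile> App (lift (compose \<rho> d d')) (App (lift (compose \<sigma> c' c)) (Var 0)) =\<^sub>\<beta>\<^sub>\<eta> Var 0 \<Colon> \<sigma>"
    by (simp only: rename_compose)
  have "affine (compose \<sigma> c' c)" "affine (compose \<rho> d d')"
    by (intro affine_compose aff dis')+
  then have "affine_pair E (compose \<sigma> c' c) (compose \<rho> d d') \<sigma> \<rho>"
    using eq ty by (simp add: affine_pair_def typing_compose)
  then show ?thesis
    unfolding fun_retract_def by blast
qed

section \<open>Compatibility with arrows, for (R2)\<close>

definition conjugate :: "'a ty \<Rightarrow> 'a ty \<Rightarrow> 'a trm \<Rightarrow> 'a trm \<Rightarrow> 'a trm" where
  "conjugate \<phi> \<sigma> t s =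
     Lam \<phi> (Lam \<sigma> (App (lift (lift t)) (App (Var 1) (App (lift (lift s)) (Var 0)))))"

lemma typing_conjugate:
  "E \<turnstile> s \<Colon> \<sigma>' \<rightarrow> \<sigma> \<Longrightarrow> E \<turnstile> t \<Colon> \<tau> \<rightarrow> \<tau>' \<Longrightarrow> E \<turnstile> conjugate (\<sigma> \<rightarrow> \<tau>) \<sigma>' t s \<Colon> (\<sigma> \<rightarrow> \<tau>) \<rightarrow> \<sigma>' \<rightarrow> \<tau>'"
  unfolding conjugate_def by (rule typing_intros | assumption | simp)+

lemma rename_conjugate: "rename r (conjugate \<phi> \<sigma> t s) = conjugate \<phi> \<sigma> (rename r t) (rename r s)"
  by (simp add: conjugate_def trm_simps)

lemma conjugate_app:
  assumes "E \<turnstile> s \<Colon> \<sigma>' \<rightarrow> \<sigma>" "E \<turnstile> t \<Colon> \<tau> \<rightarrow> \<tau>'" "E \<turnstile> f \<Colon> \<sigma> \<rightarrow> \<tau>" "E \<turnstile> u \<Colon> \<sigma>'"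
  shows "E \<turnstile> App (App (conjugate (\<sigma> \<rightarrow> \<tau>) \<sigma>' t s) f) u =\<^sub>\<beta>\<^sub>\<eta> App t (App f (App s u)) \<Colon> \<tau>'"
  unfolding conjugate_def
proof (rule beta2_eqI)
  show "\<sigma>' # (\<sigma> \<rightarrow> \<tau>) # E \<turnstile> App (lift (lift t)) (App (Var 1) (App (lift (lift s)) (Var 0))) \<Colon> \<tau>'"
    by (rule typing_intros assms | simp)+
  have "\<sigma>' # E \<turnstile> App (lift t) (App (lift f) (App (lift s) (Var 0))) \<Colon> \<tau>'"
    by (rule typing_intros assms | simp)+
  then show "\<sigma>' # E \<turnstile> subst (case_nat (Var 0) (\<lambda>i. lift (case_nat f Var i)))
      (App (lift (lift t)) (App (Var 1) (App (lift (lift s)) (Var 0)))) \<Colon> \<tau>'"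
    by (simp add: trm_simps)
qed (use assms in \<open>simp_all add: trm_simps\<close>)

lemma affine_conjugate:
  assumes "affine s" "affine t" "\<And>i. occurrences i s = 0 \<or> occurrences i t = 0"
  shows "affine (conjugate \<phi> \<sigma> t s)"
  unfolding affine_def
proof (intro conjI allI)
  show "occurrences i (conjugate \<phi> \<sigma> t s) \<le> 1" for i
    using assms(1,2) assms(3)[of i] by (auto simp: affine_def conjugate_def)
qed (use assms in \<open>simp add: affine_def conjugate_def\<close>)

text \<open>The coder decodes the argument and codes the result; the decoder does the opposite,
  which makes retraction covariant on both sides of the arrow. For
  \<open>x : \<sigma> \<rightarrow> \<tau>\<close> and \<open>y : \<sigma>\<close> the composite
  yields \<open>d' (c' (x (d (c y))))\<close>, where both pairs cancel to
  \<open>x y\<close>.\<close>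

lemma fun_retract_arrow:
  assumes "fun_retract \<sigma> \<sigma>'" "fun_retract \<tau> \<tau>'"
  shows "fun_retract (\<sigma> \<rightarrow> \<tau>) (\<sigma>' \<rightarrow> \<tau>')"
proof -
  obtain E c d c' d' where p: "affine_pair E c d \<sigma> \<sigma>'" "affine_pair E c' d' \<tau> \<tau>'"
    and dis: "\<And>i. occurrences i c = 0 \<and> occurrences i d = 0 \<or>
      occurrences i c' = 0 \<and> occurrences i d' = 0"
    using fun_retract_disjoint[OF assms] by blast
  have ty: "E \<turnstile> c \<Colon> \<sigma> \<rightarrow> \<sigma>'" "E \<turnstile> d \<Colon> \<sigma>' \<rightarrow> \<sigma>" "E \<turnstile> c' \<Colon> \<tau> \<rightarrow> \<tau>'" "E \<turnstile> d' \<Colon> \<tau>' \<rightarrow> \<tau>"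
    using p by (auto simp: affine_pair_def)
  have aff: "affine c" "affine d" "affine c'" "affine d'"
    using p by (auto simp: affine_pair_def)
  have dis': "occurrences i d = 0 \<or> occurrences i c' = 0" "occurrences i c = 0 \<or> occurrences i d' = 0" for i
    using dis[of i] by auto
  let ?C = "conjugate (\<sigma> \<rightarrow> \<tau>) \<sigma>' c' d" and ?D = "conjugate (\<sigma>' \<rightarrow> \<tau>') \<sigma> d' c"
  let ?E = "(\<sigma> \<rightarrow> \<tau>) # E" and ?F = "\<sigma> # (\<sigma> \<rightarrow> \<tau>) # E"
  let ?c = "lift (lift c)" and ?d = "lift (lift d)" and ?c' = "lift (lift c')"
    and ?d' = "lift (lift d')"
  let ?Cl = "lift (lift ?C)" and ?Dl = "lift (lift ?D)"
  have typC: "E \<turnstile> ?C \<Colon> (\<sigma> \<rightarrow> \<tau>) \<rightarrow> \<sigma>' \<rightarrow> \<tau>'" "E \<turnstile> ?D \<Colon> (\<sigma>' \<rightarrow> \<tau>') \<rightarrow> \<sigma> \<rightarrow> \<tau>"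
    by (intro typing_conjugate ty)+
  have x: "?E \<turnstile> Var 0 \<Colon> \<sigma> \<rightarrow> \<tau>"
    by (simp add: typing_VarI)
  have y: "?F \<turnstile> Var 0 \<Colon> \<sigma>" "?F \<turnstile> Var 1 \<Colon> \<sigma> \<rightarrow> \<tau>"
    by (simp_all add: typing_VarI)
  note typl = ty[THEN typing_lift[where \<sigma> = "\<sigma> \<rightarrow> \<tau>"], THEN typing_lift[where \<sigma> = \<sigma>]]
  note typCl = typC[THEN typing_lift[where \<sigma> = "\<sigma> \<rightarrow> \<tau>"], THEN typing_lift[where \<sigma> = \<sigma>]]
  note pl = p[THEN affine_pair_lift[where \<rho> = "\<sigma> \<rightarrow> \<tau>"], THEN affine_pair_lift[where \<rho> = \<sigma>]]
  have dx: "?F \<turnstile> App ?Cl (Var 1) \<Colon> \<sigma>' \<rightarrow> \<tau>'"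
    by (intro typing_App[OF _ y(2)] typCl)
  \<comment> \<open>The lift is pushed into the decoder only; \<open>?Cl\<close> stays folded, since
    here it belongs to the function argument of \<open>conjugate_app\<close>.\<close>
  have "?F \<turnstile> App (App ?Dl (App ?Cl (Var 1))) (Var 0)
      =\<^sub>\<beta>\<^sub>\<eta> App ?d' (App (App ?Cl (Var 1)) (App ?c (Var 0))) \<Colon> \<tau>"
    unfolding rename_conjugate[of _ "\<sigma>' \<rightarrow> \<tau>'"] by (intro conjugate_app typl dx y)
  also have "?F \<turnstile> App ?d' (App (App ?Cl (Var 1)) (App ?c (Var 0)))
      =\<^sub>\<beta>\<^sub>\<eta> App ?d' (App ?c' (App (Var 1) (App ?d (App ?c (Var 0))))) \<Colon> \<tau>"
    unfolding rename_conjugate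
    by (rule eq_App[OF eq_refl conjugate_app]) (rule typl typing_App[OF typl(1)] y)+
  also have "?F \<turnstile> App ?d' (App ?c' (App (Var 1) (App ?d (App ?c (Var 0)))))
      =\<^sub>\<beta>\<^sub>\<eta> App (Var 1) (App ?d (App ?c (Var 0))) \<Colon> \<tau>"
    by (rule affine_pair_app[OF pl(2)]) (rule typing_App typl y)+
  also have "?F \<turnstile> App (Var 1) (App ?d (App ?c (Var 0)))
      =\<^sub>\<beta>\<^sub>\<eta> App (Var 1) (Var 0) \<Colon> \<tau>"
    by (rule eq_App[OF eq_refl affine_pair_app[OF pl(1)]]) (rule y)+
  \<comment> \<open>Extensionality removes \<open>y\<close>: \<open>Var 1\<close> in
    \<open>?F\<close> is the lift of the variable \<open>Var 0\<close> of \<open>?E\<close>.\<close>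
  finally have eq: "?E \<turnstile> App (lift ?D) (App (lift ?C) (Var 0)) =\<^sub>\<beta>\<^sub>\<eta> Var 0 \<Colon> \<sigma> \<rightarrow> \<tau>"
    by (intro eq_ext[OF _ x]) (auto intro!: typing_App x typC typing_lift)
  have "affine ?C" "affine ?D"
    by (intro affine_conjugate aff dis')+
  then have "affine_pair E ?C ?D (\<sigma> \<rightarrow> \<tau>) (\<sigma>' \<rightarrow> \<tau>')"
    using eq typC by (simp add: affine_pair_def)
  then show ?thesis
    unfolding fun_retract_def by blast
qed

section \<open>Exchange of arguments\<close>

definition swap :: "'a ty \<Rightarrow> 'a ty \<Rightarrow> 'a ty \<Rightarrow> 'a trm" where
  "swap \<sigma> \<tau> \<rho> = Lam (\<sigma> \<rightarrow> \<tau> \<rightarrow> \<rho>) (Lam \<tau> (Lam \<sigma> (App (App (Var 2) (Var 0)) (Var 1))))"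

lemma typing_swap: "E \<turnstile> swap \<sigma> \<tau> \<rho> \<Colon> (\<sigma> \<rightarrow> \<tau> \<rightarrow> \<rho>) \<rightarrow> \<tau> \<rightarrow> \<sigma> \<rightarrow> \<rho>"
proof -
  let ?E = "\<sigma> # \<tau> # (\<sigma> \<rightarrow> \<tau> \<rightarrow> \<rho>) # E"
  have "?E \<turnstile> Var 2 \<Colon> \<sigma> \<rightarrow> \<tau> \<rightarrow> \<rho>" "?E \<turnstile> Var 0 \<Colon> \<sigma>" "?E \<turnstile> Var 1 \<Colon> \<tau>"
    by (simp_all add: typing_VarI)
  then show ?thesis
    unfolding swap_def by (blast intro: typing_App typing_Lam)
qed

lemma rename_swap: "rename r (swap \<sigma> \<tau> \<rho>) = swap \<sigma> \<tau> \<rho>"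
  by (simp add: swap_def numeral_2_eq_2)

lemma swap_app:
  assumes "E \<turnstile> f \<Colon> \<sigma> \<rightarrow> \<tau> \<rightarrow> \<rho>" "E \<turnstile> t \<Colon> \<tau>" "E \<turnstile> s \<Colon> \<sigma>"
  shows "E \<turnstile> App (App (App (swap \<sigma> \<tau> \<rho>) f) t) s =\<^sub>\<beta>\<^sub>\<eta> App (App f s) t \<Colon> \<rho>"
proof -
  let ?b = "Lam \<sigma> (App (App (lift (lift f)) (Var 0)) (Var 1))"
  \<comment> \<open>The type of the body under the first binder is read off this judgement by
    inversion.\<close>
  have "E \<turnstile> Lam (\<sigma> \<rightarrow> \<tau> \<rightarrow> \<rho>) (Lam \<tau> (Lam \<sigma> (App (App (Var 2) (Var 0)) (Var 1)))) \<Colon>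
      (\<sigma> \<rightarrow> \<tau> \<rightarrow> \<rho>) \<rightarrow> \<tau> \<rightarrow> \<sigma> \<rightarrow> \<rho>"
    using typing_swap unfolding swap_def .
  then have body: "\<tau> # (\<sigma> \<rightarrow> \<tau> \<rightarrow> \<rho>) # E \<turnstile> Lam \<sigma> (App (App (Var 2) (Var 0)) (Var 1)) \<Colon> \<sigma> \<rightarrow> \<rho>"
    by (auto elim: typing.cases)
  have bt: "\<tau> # E \<turnstile> ?b \<Colon> \<sigma> \<rightarrow> \<rho>"
    by (rule typing_intros assms | simp)+
  have "E \<turnstile> App (App (swap \<sigma> \<tau> \<rho>) f) t =\<^sub>\<beta>\<^sub>\<eta> Lam \<sigma> (App (App (lift f) (Var 0)) (lift t)) \<Colon> \<sigma> \<rightarrow> \<rho>"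
    unfolding swap_def using assms body bt
    by (intro beta2_eqI) (auto simp: trm_simps numeral_2_eq_2)
  moreover have "E \<turnstile> App (Lam \<sigma> (App (App (lift f) (Var 0)) (lift t))) s =\<^sub>\<beta>\<^sub>\<eta> App (App f s) t \<Colon> \<rho>"
  proof (rule beta_eqI)
    show "\<sigma> # E \<turnstile> App (App (lift f) (Var 0)) (lift t) \<Colon> \<rho>"
      by (rule typing_intros assms | simp)+
  qed (use assms in \<open>simp_all add: trm_simps\<close>)
  ultimately show ?thesis
    using assms(3) by (blast intro: eq_trans eq_App eq_refl)
qed

text \<open>The inverse of a swap is the swap with the two types exchanged. This is computed on two
  further variables, which extensionality then removes one at a time, the innermost first.\<close>

lemma fun_retract_swap: "fun_retract (\<sigma> \<rightarrow> \<tau> \<rightarrow> \<rho>) (\<tau> \<rightarrow> \<sigma> \<rightarrow> \<rho>)"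
proof -
  let ?\<phi> = "\<sigma> \<rightarrow> \<tau> \<rightarrow> \<rho>"
  let ?E = "[\<tau>, \<sigma>, ?\<phi>]"
  have x: "[?\<phi>] \<turnstile> Var 0 \<Colon> ?\<phi>" "[\<sigma>, ?\<phi>] \<turnstile> Var 1 \<Colon> ?\<phi>" "[\<sigma>, ?\<phi>] \<turnstile> Var 0 \<Colon> \<sigma>"
    "?E \<turnstile> Var 0 \<Colon> \<tau>" "?E \<turnstile> Var 1 \<Colon> \<sigma>" "?E \<turnstile> Var 2 \<Colon> ?\<phi>"
    by (simp_all add: typing_VarI)
  have "?E \<turnstile> App (App (App (swap \<tau> \<sigma> \<rho>) (App (swap \<sigma> \<tau> \<rho>) (Var 2))) (Var 1)) (Var 0)
      =\<^sub>\<beta>\<^sub>\<eta> App (App (App (swap \<sigma> \<tau> \<rho>) (Var 2)) (Var 0)) (Var 1) \<Colon> \<rho>"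
    by (intro swap_app x typing_App[OF typing_swap])
  also have "?E \<turnstile> App (App (App (swap \<sigma> \<tau> \<rho>) (Var 2)) (Var 0)) (Var 1)
      =\<^sub>\<beta>\<^sub>\<eta> App (App (Var 2) (Var 1)) (Var 0) \<Colon> \<rho>"
    by (intro swap_app x)
  finally have "?E \<turnstile> App (lift (App (App (swap \<tau> \<sigma> \<rho>) (App (swap \<sigma> \<tau> \<rho>) (Var 1))) (Var 0))) (Var 0)
      =\<^sub>\<beta>\<^sub>\<eta> App (lift (App (Var 1) (Var 0))) (Var 0) \<Colon> \<rho>"
    by (simp add: rename_swap numeral_2_eq_2)
  then have "[\<sigma>, ?\<phi>] \<turnstile> App (App (swap \<tau> \<sigma> \<rho>) (App (swap \<sigma> \<tau> \<rho>) (Var 1))) (Var 0)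
      =\<^sub>\<beta>\<^sub>\<eta> App (Var 1) (Var 0) \<Colon> \<tau> \<rightarrow> \<rho>"
    by (rule eq_ext[rotated -1]) (rule typing_App typing_swap x)+
  then have "[\<sigma>, ?\<phi>] \<turnstile> App (lift (App (swap \<tau> \<sigma> \<rho>) (App (swap \<sigma> \<tau> \<rho>) (Var 0)))) (Var 0)
      =\<^sub>\<beta>\<^sub>\<eta> App (lift (Var 0)) (Var 0) \<Colon> \<tau> \<rightarrow> \<rho>"
    by (simp add: rename_swap)
  then have eq: "[?\<phi>] \<turnstile> App (swap \<tau> \<sigma> \<rho>) (App (swap \<sigma> \<tau> \<rho>) (Var 0)) =\<^sub>\<beta>\<^sub>\<eta> Var 0 \<Colon> ?\<phi>"
    by (rule eq_ext[rotated -1]) (rule typing_App typing_swap x)+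
  have "affine (swap \<sigma> \<tau> \<rho>)" for \<sigma> \<tau> \<rho> :: "'a ty"
    by (simp add: affine_def swap_def)
  then have "affine_pair [] (swap \<sigma> \<tau> \<rho>) (swap \<tau> \<sigma> \<rho>) ?\<phi> (\<tau> \<rightarrow> \<sigma> \<rightarrow> \<rho>)"
    using eq by (simp add: affine_pair_def typing_swap rename_swap)
  then show ?thesis
    unfolding fun_retract_def by blast
qed

section \<open>Identity and isomorphic types\<close>

lemma fun_retract_refl: "fun_retract \<sigma> \<sigma>"
proof -
  have id: "E \<turnstile> Lam \<sigma> (Var 0) \<Colon> \<sigma> \<rightarrow> \<sigma>" for E :: "'a ty list"
    by (simp add: typing_Lam typing_VarI)
  have app: "[\<sigma>] \<turnstile> App (Lam \<sigma> (Var 0)) (Var 0) =\<^sub>\<beta>\<^sub>\<eta> Var 0 \<Colon> \<sigma>"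
    by (rule beta_eqI) (simp_all add: typing_VarI)
  then have "[\<sigma>] \<turnstile> App (Lam \<sigma> (Var 0)) (App (Lam \<sigma> (Var 0)) (Var 0)) =\<^sub>\<beta>\<^sub>\<eta> Var 0 \<Colon> \<sigma>"
    using id by (blast intro: eq_trans eq_App eq_refl)
  then have "affine_pair [] (Lam \<sigma> (Var 0)) (Lam \<sigma> (Var 0)) \<sigma> \<sigma>"
    using id by (simp add: affine_pair_def affine_def)
  then show ?thesis
    unfolding fun_retract_def by blast
qed

text \<open>Carrying both directions at once is what makes the symmetry rule go through in the
  induction.\<close>

lemma iso_imp_fun_retract: "\<sigma> \<sim> \<tau> \<Longrightarrow> fun_retract \<sigma> \<tau> \<and> fun_retract \<tau> \<sigma>"
  by (induction rule: ty_iso.induct)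
    (auto intro: fun_retract_refl fun_retract_trans fun_retract_arrow fun_retract_swap)

text \<open>The argument discarded by the coder is supplied by a free variable of the decoder.\<close>

lemma fun_retract_weaken: "fun_retract \<sigma> (\<tau> \<rightarrow> \<sigma>)"
proof -
  \<comment> \<open>Under its binder, \<open>Var 1\<close> in \<open>?d\<close> is the entry of the
    environment \<open>[\<tau>]\<close>. Once \<open>x : \<sigma>\<close> is put in front, the same
    variable outside the binder is again \<open>Var 1\<close>.\<close>
  let ?c = "Lam \<sigma> (Lam \<tau> (Var 1))" and ?d = "Lam (\<tau> \<rightarrow> \<sigma>) (App (Var 0) (Var 1))"
  have c: "E \<turnstile> ?c \<Colon> \<sigma> \<rightarrow> \<tau> \<rightarrow> \<sigma>" for E :: "'a ty list"
    by (intro typing_Lam typing_VarI) auto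
  have d: "[\<tau>] \<turnstile> ?d \<Colon> (\<tau> \<rightarrow> \<sigma>) \<rightarrow> \<sigma>"
    by (rule typing_intros | simp)+
  have "[\<sigma>, \<tau>] \<turnstile> App (lift ?d) (App (lift ?c) (Var 0))
      =\<^sub>\<beta>\<^sub>\<eta> App (App (lift ?c) (Var 0)) (Var 1) \<Colon> \<sigma>"
    unfolding rename.simps(3)[of _ "\<tau> \<rightarrow> \<sigma>"]
  proof (rule beta_eqI)
    show "[\<tau> \<rightarrow> \<sigma>, \<sigma>, \<tau>] \<turnstile> rename (case_nat 0 (\<lambda>i. Suc (Suc i))) (App (Var 0) (Var 1)) \<Colon> \<sigma>"
      by (simp, rule typing_App[of _ _ \<tau>]) (simp_all add: typing_VarI)
    show "[\<sigma>, \<tau>] \<turnstile> App (lift ?c) (Var 0) \<Colon> \<tau> \<rightarrow> \<sigma>"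
      by (rule typing_App[OF typing_lift[OF c]]) (simp add: typing_VarI)
  qed simp
  also have "[\<sigma>, \<tau>] \<turnstile> App (App (lift ?c) (Var 0)) (Var 1) =\<^sub>\<beta>\<^sub>\<eta> Var 0 \<Colon> \<sigma>"
    unfolding rename.simps(3) by (rule beta2_eqI) (simp_all add: typing_VarI)
  finally have "affine_pair [\<tau>] ?c ?d \<sigma> (\<tau> \<rightarrow> \<sigma>)"
    using c d by (simp add: affine_pair_def affine_def)
  then show ?thesis
    unfolding fun_retract_def by blast
qed

text \<open>The decoder for (A4): for \<open>\<sigma> = \<sigma>\<^sub>1 \<rightarrow> \<dots> \<rightarrow> \<sigma>\<^sub>k \<rightarrow> a\<close> it is convertible to
  \<open>\<lambda>g y\<^sub>1 \<dots> y\<^sub>k. g (\<lambda>s. s y\<^sub>1 \<dots> y\<^sub>k)\<close>.\<close>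

primrec dn_decoder :: "'a \<Rightarrow> 'a ty \<Rightarrow> 'a trm" where
  "dn_decoder a (Atom b) =
     Lam ((Atom b \<rightarrow> Atom a) \<rightarrow> Atom a) (App (Var 0) (Lam (Atom b) (Var 0)))"
| "dn_decoder a (\<sigma> \<rightarrow> \<tau>) =
     Lam (((\<sigma> \<rightarrow> \<tau>) \<rightarrow> Atom a) \<rightarrow> Atom a) (Lam \<sigma> (App (dn_decoder a \<tau>)
       (Lam (\<tau> \<rightarrow> Atom a) (App (Var 2) (Lam (\<sigma> \<rightarrow> \<tau>) (App (Var 1) (App (Var 0) (Var 2))))))))"

text \<open>The decoder is closed, so lifts and substitutions leave it alone.\<close>

lemma rename_dn_decoder: "rename r (dn_decoder a \<sigma>) = dn_decoder a \<sigma>"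
  by (induction \<sigma> arbitrary: r) (simp_all add: numeral_2_eq_2)

lemma subst_dn_decoder: "subst f (dn_decoder a \<sigma>) = dn_decoder a \<sigma>"
  by (induction \<sigma> arbitrary: f) (simp_all add: numeral_2_eq_2)

lemma occurrences_dn_decoder: "occurrences i (dn_decoder a \<sigma>) = 0"
  by (induction \<sigma> arbitrary: i) simp_all

lemma affine_dn_decoder: "affine (dn_decoder a \<sigma>)"
proof -
  have "bound_affine (dn_decoder a \<sigma>)"
    by (induction \<sigma>) (simp_all add: occurrences_dn_decoder)
  then show ?thesis
    by (simp add: affine_def occurrences_dn_decoder)
qed

text \<open>The head condition is passed down to the final atom \<open>b\<close>, where the identity
  on \<open>b\<close> must have type \<open>Atom b \<rightarrow> Atom a\<close>.\<close>

lemma typing_dn_decoder: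
  "head \<sigma> = a \<Longrightarrow> E \<turnstile> dn_decoder a \<sigma> \<Colon> ((\<sigma> \<rightarrow> Atom a) \<rightarrow> Atom a) \<rightarrow> \<sigma>"
proof (induction \<sigma> arbitrary: E)
  case (Atom b)
  show ?case
    using Atom by simp (rule typing_intros | simp)+
next
  case (Arrow \<sigma> \<tau>)
  show ?case
    unfolding dn_decoder.simps
    by (rule typing_Lam typing_App Arrow.IH(2) typing_VarI | use Arrow.prems in simp)+
qed

text \<open>At \<open>\<sigma> \<rightarrow> \<tau>\<close>, decoding \<open>\<lambda>k. k x\<close>
  and applying the result to \<open>y\<close> gives the decoder at \<open>\<tau>\<close> applied to
  \<open>\<lambda>k. (\<lambda>k. k x) (\<lambda>s. k (s y))\<close>, hence to
  \<open>\<lambda>k. k (x y)\<close>. The induction hypothesis is used for \<open>x y\<close>, in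
  the environment extended by \<open>y\<close>.\<close>

lemma dn_decoder_app:
  assumes "head \<sigma> = a" "E \<turnstile> x \<Colon> \<sigma>"
  shows "E \<turnstile> App (dn_decoder a \<sigma>) (Lam (\<sigma> \<rightarrow> Atom a) (App (Var 0) (lift x))) =\<^sub>\<beta>\<^sub>\<eta> x \<Colon> \<sigma>"
  using assms
proof (induction \<sigma> arbitrary: E x)
  case (Atom b)
  then have x: "E \<turnstile> x \<Colon> Atom a" and [simp]: "b = a"
    by auto
  let ?X = "Lam (Atom a \<rightarrow> Atom a) (App (Var 0) (lift x))" and ?I = "Lam (Atom a) (Var 0)"
  have X: "(Atom a \<rightarrow> Atom a) # E \<turnstile> App (Var 0) (lift x) \<Colon> Atom a"
    by (rule typing_intros x | simp)+
  have I: "F \<turnstile> ?I \<Colon> Atom a \<rightarrow> Atom a" for F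
    by (rule typing_intros | simp)+
  have "E \<turnstile> App (dn_decoder a (Atom a)) ?X =\<^sub>\<beta>\<^sub>\<eta> App ?X ?I \<Colon> Atom a"
    unfolding dn_decoder.simps
    by (rule beta_eqI) (auto intro: typing_App[OF typing_VarI I] typing_Lam X)
  also have "E \<turnstile> App ?X ?I =\<^sub>\<beta>\<^sub>\<eta> App ?I x \<Colon> Atom a"
    by (rule beta_eqI[OF X I]) (simp add: trm_simps)
  also have "E \<turnstile> App ?I x =\<^sub>\<beta>\<^sub>\<eta> x \<Colon> Atom a"
    by (rule beta_eqI) (simp_all add: x typing_VarI)
  finally show ?case by simp
next
  case (Arrow \<sigma> \<tau>)
  let ?\<phi> = "\<sigma> \<rightarrow> \<tau>"
  let ?X = "\<lambda>x. Lam (?\<phi> \<rightarrow> Atom a) (App (Var 0) (lift x))"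
  let ?x = "lift (lift x)"
  let ?S = "Lam ?\<phi> (App (Var 1) (App (Var 0) (Var 2)))"
  let ?F = "\<sigma> # E" and ?G = "(\<tau> \<rightarrow> Atom a) # \<sigma> # E"
  have x: "E \<turnstile> x \<Colon> ?\<phi>" by (rule Arrow.prems)
  have X: "F \<turnstile> ?X y \<Colon> (?\<phi> \<rightarrow> Atom a) \<rightarrow> Atom a" if "F \<turnstile> y \<Colon> ?\<phi>" for F y
    by (rule typing_intros that | simp)+
  have S: "(\<tau> \<rightarrow> Atom a) # \<sigma> # F \<turnstile> ?S \<Colon> ?\<phi> \<rightarrow> Atom a" for F
    by (rule typing_intros | simp)+
  have D: "F \<turnstile> dn_decoder a \<tau> \<Colon> ((\<tau> \<rightarrow> Atom a) \<rightarrow> Atom a) \<rightarrow> \<tau>" for F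
    using Arrow.prems by (simp add: typing_dn_decoder)
  have xy: "?F \<turnstile> App (lift x) (Var 0) \<Colon> \<tau>"
    by (rule typing_intros x | simp)+
  have xy': "?G \<turnstile> App ?x (Var 1) \<Colon> \<tau>"
    by (rule typing_intros x | simp)+
  \<comment> \<open>In \<open>?G\<close>, \<open>Var 0\<close> is the continuation \<open>k\<close>
    and \<open>Var 1\<close> is \<open>y\<close>; two contractions lead to
    \<open>k (x y)\<close>.\<close>
  have "?G \<turnstile> App (?X ?x) ?S =\<^sub>\<beta>\<^sub>\<eta> App ?S ?x \<Colon> Atom a"
  proof (rule beta_eqI[OF _ S])
    show "(?\<phi> \<rightarrow> Atom a) # ?G \<turnstile> App (Var 0) (lift ?x) \<Colon> Atom a"
      by (rule typing_intros x | simp)+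
  qed (simp add: trm_simps)
  also have "?G \<turnstile> App ?S ?x =\<^sub>\<beta>\<^sub>\<eta> App (Var 0) (App ?x (Var 1)) \<Colon> Atom a"
  proof (rule beta_eqI)
    show "?\<phi> # ?G \<turnstile> App (Var 1) (App (Var 0) (Var 2)) \<Colon> Atom a"
      by (rule typing_intros | simp)+
    show "?G \<turnstile> ?x \<Colon> ?\<phi>"
      by (intro typing_lift x)
  qed (simp add: numeral_2_eq_2)
  finally have inner: "?G \<turnstile> App (?X ?x) ?S =\<^sub>\<beta>\<^sub>\<eta> App (Var 0) (App ?x (Var 1)) \<Colon> Atom a" .
  have body: "\<sigma> # ((?\<phi> \<rightarrow> Atom a) \<rightarrow> Atom a) # ?F \<turnstile>
      App (dn_decoder a \<tau>) (Lam (\<tau> \<rightarrow> Atom a) (App (Var 2) ?S)) \<Colon> \<tau>"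
    by (rule typing_App[OF D] typing_Lam typing_App[OF _ S] typing_VarI | simp)+
  \<comment> \<open>After the first contraction the argument is still a bound variable, distinct
    from the \<open>y\<close> of \<open>?F\<close>; hence the additional lift of
    \<open>x\<close>.\<close>
  have body': "\<sigma> # ?F \<turnstile> App (dn_decoder a \<tau>) (Lam (\<tau> \<rightarrow> Atom a) (App (?X (lift ?x)) ?S)) \<Colon> \<tau>"
    by (intro typing_App[OF D] typing_Lam typing_App[OF X S] typing_lift x)
  have "?F \<turnstile> App (App (dn_decoder a ?\<phi>) (?X (lift x))) (Var 0)
      =\<^sub>\<beta>\<^sub>\<eta> App (dn_decoder a \<tau>) (Lam (\<tau> \<rightarrow> Atom a) (App (?X ?x) ?S)) \<Colon> \<tau>"
    unfolding dn_decoder.simps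
    by (rule beta2_eqI[OF body X])
      (use body' in \<open>simp_all add: x typing_lift typing_VarI subst_dn_decoder trm_simps numeral_2_eq_2\<close>)
  also have "?F \<turnstile> App (dn_decoder a \<tau>) (Lam (\<tau> \<rightarrow> Atom a) (App (?X ?x) ?S))
      =\<^sub>\<beta>\<^sub>\<eta> App (dn_decoder a \<tau>) (Lam (\<tau> \<rightarrow> Atom a) (App (Var 0) (App ?x (Var 1)))) \<Colon> \<tau>"
    by (intro eq_App[OF eq_refl[OF D]] eq_Lam inner)
  also have "?F \<turnstile> App (dn_decoder a \<tau>) (Lam (\<tau> \<rightarrow> Atom a) (App (Var 0) (App ?x (Var 1))))
      =\<^sub>\<beta>\<^sub>\<eta> App (lift x) (Var 0) \<Colon> \<tau>"
    using Arrow.IH(2)[OF _ xy] Arrow.prems by simp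
  finally show ?case
    by (intro eq_ext x typing_App[OF typing_dn_decoder X] Arrow.prems)
      (simp add: rename_dn_decoder trm_simps del: dn_decoder.simps)
qed

lemma fun_retract_double_negation:
  assumes "head \<sigma> = a"
  shows "fun_retract \<sigma> ((\<sigma> \<rightarrow> Atom a) \<rightarrow> Atom a)"
proof -
  let ?c = "Lam \<sigma> (Lam (\<sigma> \<rightarrow> Atom a) (App (Var 0) (Var 1)))"
  \<comment> \<open>\<open>lift (Var 0)\<close> is kept in this form to match
    \<open>dn_decoder_app\<close> with \<open>Var 0\<close> for \<open>x\<close>.\<close>
  let ?X = "Lam (\<sigma> \<rightarrow> Atom a) (App (Var 0) (lift (Var 0)))"
  have c: "E \<turnstile> ?c \<Colon> \<sigma> \<rightarrow> (\<sigma> \<rightarrow> Atom a) \<rightarrow> Atom a" for E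
    by (rule typing_intros | simp)+
  have x: "[\<sigma>] \<turnstile> Var 0 \<Colon> \<sigma>"
    by (simp add: typing_VarI)
  have "[\<sigma>] \<turnstile> App ?c (Var 0) =\<^sub>\<beta>\<^sub>\<eta> ?X \<Colon> (\<sigma> \<rightarrow> Atom a) \<rightarrow> Atom a"
  proof (rule beta_eqI[OF _ x])
    show "[\<sigma>, \<sigma>] \<turnstile> Lam (\<sigma> \<rightarrow> Atom a) (App (Var 0) (Var 1)) \<Colon> (\<sigma> \<rightarrow> Atom a) \<rightarrow> Atom a"
      by (rule typing_intros | simp)+
  qed simp
  then have "[\<sigma>] \<turnstile> App (dn_decoder a \<sigma>) (App ?c (Var 0)) =\<^sub>\<beta>\<^sub>\<eta> App (dn_decoder a \<sigma>) ?X \<Colon> \<sigma>"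
    by (rule eq_App[OF eq_refl[OF typing_dn_decoder[OF assms]]])
  also have "[\<sigma>] \<turnstile> App (dn_decoder a \<sigma>) ?X =\<^sub>\<beta>\<^sub>\<eta> Var 0 \<Colon> \<sigma>"
    by (rule dn_decoder_app[OF assms x])
  finally have "affine_pair [] ?c (dn_decoder a \<sigma>) \<sigma> ((\<sigma> \<rightarrow> Atom a) \<rightarrow> Atom a)"
    using c affine_dn_decoder[of a \<sigma>] typing_dn_decoder[OF assms]
    by (simp add: affine_pair_def rename_dn_decoder) (simp add: affine_def)
  then show ?thesis
    unfolding fun_retract_def by blast
qed

lemma LPS_imp_fun_retract: "LPS \<sigma> \<tau> \<Longrightarrow> fun_retract \<sigma> \<tau>"
proof (induction rule: LPS.induct)
  case (LPS_iso \<rho> \<tau> \<rho>' \<tau>')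
  \<comment> \<open>The retraction is composed with those given by the two isomorphisms: from
    \<open>\<rho>'\<close> to \<open>\<rho>\<close>, then \<open>\<tau>\<close>, then
    \<open>\<tau>'\<close>.\<close>
  then show ?case
    by (meson fun_retract_trans iso_imp_fun_retract)
qed (auto intro: fun_retract_refl fun_retract_weaken fun_retract_double_negation
    fun_retract_trans fun_retract_arrow)

theorem proposition3p2:
  fixes \<sigma> \<tau> :: "'a ty"
  shows "(CF \<sigma> \<tau> \<longrightarrow> LPS \<sigma> \<tau>) \<and> (CF \<sigma> \<tau> \<longrightarrow> affine_retract \<sigma> \<tau>)"
  using CF_imp_LPS LPS_imp_fun_retract affine_pair_imp_affine_retract fun_retract_def by blast

end
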